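(* VRASED computes remote attestation soundly. That is, every execution of the VRASED system (a trace satisfying the memory model, the execution model, the hardware specifications (a)–(j) and the functional correctness of the attestation code $\mathsf{SW\text{-}Att}$, all given in the context) satisfies, for every value $M$ of the attested region $AR$ and every challenge value $Chal$, the LTL formula $$\mathbf{G}\,\Big\{\, PC = CR_{min} \,\land\, AR = M \,\land\, MR = Chal \,\land\, \big[(\neg reset)\ \mathbf{U}\ (PC = CR_{max})\big] \;\rightarrow\; \mathbf{F}\,\big[\,PC = CR_{max} \,\land\, MR = HMAC(KDF(K,Chal), M)\,\big]\,\Big\},$$ where $K$ is the secret attestation key and $KDF$ is a secure key derivation function.
   Context: **Logic.** Formulas are in Linear Temporal Logic (LTL), interpreted on infinite traces of system states indexed by discrete time. $\mathbf{X}\phi$: $\phi$ holds at the next state, and $\mathbf{X}(s)$ denotes the next value of signal $s$. $\mathbf{F}\phi$: $\phi$ holds at some future state. $\mathbf{G}\phi$: $\phi$ holds at all future states. $\phi\,\mathbf{U}\,\psi$: there is a future state where $\psi$ holds, and $\phi$ holds at all states prior to it. (The future includes the present.) Implication binds weaker than $\land,\lor$. **Signals at each state of the microcontroller (MCU).** $PC$ (program counter: address of the instruction being executed), $irq$ (1 bit), $R_{en}$, $W_{en}$ (1-bit CPU read/write enables), $D_{addr}$ (address of a CPU memory access), $DMA_{en}$ (1 bit), $DMA_{addr}$ (address accessed by the DMA controller), $reset$ (1-bit output of the VRASED hardware module). **Memory regions.** For addresses $A\le B$, $C\in[A,B]$ means $A\le C\le B$. $CR=[CR_{min},CR_{max}]$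 is the region storing the code $\mathsf{SW\text{-}Att}$ ($CR_{min}$, $CR_{max}$ are the addresses of its first and last instructions). $KR=[K_{min},K_{max}]$ stores the key $K$. $XS=[XS_{min},XS_{max}]$ is the stack region reserved for $\mathsf{SW\text{-}Att}$. $MR=[MAC_{addr},MAC_{addr}+MAC_{size}-1]$ holds the challenge as input and receives the HMAC result as output. $AR=[AR_{min},AR_{max}]$ is the attested region. An equation such as $AR=M$ means that the current content of the region equals $M$. **Memory model.** $\mathbf{G}\{KR=K\}$; $\mathbf{G}\{CR=\mathsf{SW\text{-}Att}\}$; the regions $MR,CR,AR,KR,XS$ are pairwise non-overlapping. **Execution model.** $\mathrm{Modify\_Mem}(i)$ means that the content of address $i$ is modified at the current step (the content of address $i$ can differ between one state and the next only if $\mathrm{Modify\_Mem}(i)$ holds at the former); $\mathrm{Read\_Mem}(i)$ means that address $i$ is read. At every state: - $\mathrm{Modify\_Mem}(i)\rightarrow (W_{en}\land D_{addr}=i)\lor(DMA_{en}\land DMA_{addr}=i)$; - $\mathrm{Read\_Mem}(i)\rightarrow (R_{en}\land D_{addr}=i)\lor(DMA_{en}\land DMA_{addr}=i)$; - an interrupt occurring implies $irq$. **Hardware specifications (verified for VRASED's hardware module).** (a) $\mathbf{G}\{\neg(PC\in CR)\land R_{en}\land (D_{addr}\in KR)\rightarrow reset\}$ (b) $\mathbf{G}\{[\neg reset\land (PC\in CR)\land\neg(\mathbf{X}(PC)\in CR)]\rightarrow[PC=CR_{max}\lor\mathbf{X}(reset)]\}$ (c) $\mathbf{G}\{[\neg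 reset\land\neg(PC\in CR)\land(\mathbf{X}(PC)\in CR)]\rightarrow[\mathbf{X}(PC)=CR_{min}\lor\mathbf{X}(reset)]\}$ (d) $\mathbf{G}\{irq\land(PC\in CR)\rightarrow reset\}$ (e) $\mathbf{G}\{\neg(PC\in CR)\land(R_{en}\lor W_{en})\land(D_{addr}\in XS)\rightarrow reset\}$ (f) $\mathbf{G}\{(PC\in CR)\land W_{en}\land\neg(D_{addr}\in XS)\land\neg(D_{addr}\in MR)\rightarrow reset\}$ (g) $\mathbf{G}\{DMA_{en}\land(DMA_{addr}\in KR)\rightarrow reset\}$ (h) $\mathbf{G}\{DMA_{en}\land(DMA_{addr}\in XS)\rightarrow reset\}$ (i) $\mathbf{G}\{(PC\in CR)\land DMA_{en}\rightarrow reset\}$ (j) $\mathbf{G}\{reset\rightarrow[(reset\ \mathbf{U}\ PC=0)\lor\mathbf{G}(reset)]\}$ **Functional correctness of $\mathsf{SW\text{-}Att}$ (guaranteed by the verified software).** For all values $M$ of $AR$ and all $Chal$: $$\mathbf{G}\{PC=CR_{min}\land MR=Chal\land[(\neg reset\land\neg irq\land CR=\mathsf{SW\text{-}Att}\land KR=K\land AR=M)\ \mathbf{U}\ PC=CR_{max}]\rightarrow\mathbf{F}[PC=CR_{max}\land MR=HMAC(KDF(K,Chal),M)]\}.$$ *)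

theory Defs
  imports "HOL-Library.Linear_Temporal_Logic_on_Streams"
begin

text \<open>
  Traces are streams of states, and LTL is that of the library: \<open>alw\<close> is G, \<open>ev\<close> is F, \<open>nxt\<close> is X.
  The until of the specifications requires its goal to be reached, so it is \<open>suntil\<close>; the
  library's \<open>until\<close> is the weak one.
\<close>

type_synonym addr = nat

record 'b mcu_state =
  PC :: addr
  irq :: bool
  R_en :: bool
  W_en :: bool
  D_addr :: addr
  DMA_en :: bool
  DMA_addr :: addr
  reset :: bool
  mem :: "addr \<Rightarrow> 'b"
  Modify_Mem :: "addr \<Rightarrow> bool"
  Read_Mem :: "addr \<Rightarrow> bool"
  interrupt :: bool \<comment> \<open>an interrupt actually occurs, as opposed to the signal \<open>irq\<close>\<close>

type_synonym region = "addr \<times> addr" \<comment> \<open>first and last address, both included\<close>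

definition addrs :: "region \<Rightarrow> addr set" where
  "addrs r = {fst r..snd r}"

definition content :: "region \<Rightarrow> 'b mcu_state \<Rightarrow> 'b list" where
  "content r s = map (mem s) [fst r..<Suc (snd r)]"

record layout =
  CR_min :: addr
  CR_max :: addr
  K_min :: addr
  K_max :: addr
  XS_min :: addr
  XS_max :: addr
  AR_min :: addr
  AR_max :: addr
  MAC_addr :: addr
  MAC_size :: nat

definition CR :: "layout \<Rightarrow> region" where "CR L = (CR_min L, CR_max L)"
definition KR :: "layout \<Rightarrow> region" where "KR L = (K_min L, K_max L)"
definition XS :: "layout \<Rightarrow> region" where "XS L = (XS_min L, XS_max L)"
definition AR :: "layout \<Rightarrow> region" where "AR L = (AR_min L, AR_max L)"
definition MR :: "layout \<Rightarrow> region" where "MR L = (MAC_addr L, MAC_addr L + MAC_size L - 1)"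

text \<open>The condition on \<open>MAC_size\<close> says that \<open>MR\<close> is nonempty, and avoids truncated subtraction.\<close>

definition valid_layout :: "layout \<Rightarrow> bool" where
  "valid_layout L \<longleftrightarrow>
     CR_min L \<le> CR_max L \<and> K_min L \<le> K_max L \<and> XS_min L \<le> XS_max L \<and>
     AR_min L \<le> AR_max L \<and> 1 \<le> MAC_size L \<and>
     sorted_wrt (\<lambda>r r'. disjnt (addrs r) (addrs r')) [MR L, CR L, AR L, KR L, XS L]"

definition memory_model :: "layout \<Rightarrow> 'b list \<Rightarrow> 'b list \<Rightarrow> 'b mcu_state stream \<Rightarrow> bool" where
  "memory_model L SW_Att K \<omega> \<longleftrightarrow>
     alw (holds (\<lambda>s. content (KR L) s = K)) \<omega> \<and>
     alw (holds (\<lambda>s. content (CR L) s = SW_Att)) \<omega> \<and>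
     valid_layout L"

definition execution_model :: "'b mcu_state stream \<Rightarrow> bool" where
  "execution_model \<omega> \<longleftrightarrow>
     alw (\<lambda>\<omega>. \<forall>i. mem (shd (stl \<omega>)) i \<noteq> mem (shd \<omega>) i \<longrightarrow> Modify_Mem (shd \<omega>) i) \<omega> \<and>
     alw (holds (\<lambda>s. \<forall>i. Modify_Mem s i \<longrightarrow>
       (W_en s \<and> D_addr s = i) \<or> (DMA_en s \<and> DMA_addr s = i))) \<omega> \<and>
     alw (holds (\<lambda>s. \<forall>i. Read_Mem s i \<longrightarrow>
       (R_en s \<and> D_addr s = i) \<or> (DMA_en s \<and> DMA_addr s = i))) \<omega> \<and>
     alw (holds (\<lambda>s. interrupt s \<longrightarrow> irq s)) \<omega>"

abbreviation PC_in_CR :: "layout \<Rightarrow> 'b mcu_state \<Rightarrow> bool" where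
  "PC_in_CR L s \<equiv> PC s \<in> addrs (CR L)"

definition hardware_spec :: "layout \<Rightarrow> 'b mcu_state stream \<Rightarrow> bool" where
  "hardware_spec L \<omega> \<longleftrightarrow>
     alw (holds (\<lambda>s. \<not> PC_in_CR L s \<and> R_en s \<and> D_addr s \<in> addrs (KR L) \<longrightarrow> reset s)) \<omega> \<and>
     alw ((holds (\<lambda>s. \<not> reset s \<and> PC_in_CR L s) aand not (nxt (holds (PC_in_CR L))))
       impl (holds (\<lambda>s. PC s = CR_max L) or nxt (holds reset))) \<omega> \<and>
     alw ((holds (\<lambda>s. \<not> reset s \<and> \<not> PC_in_CR L s) aand nxt (holds (PC_in_CR L)))
       impl (nxt (holds (\<lambda>s. PC s = CR_min L)) or nxt (holds reset))) \<omega> \<and>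
     alw (holds (\<lambda>s. irq s \<and> PC_in_CR L s \<longrightarrow> reset s)) \<omega> \<and>
     alw (holds (\<lambda>s. \<not> PC_in_CR L s \<and> (R_en s \<or> W_en s) \<and> D_addr s \<in> addrs (XS L)
       \<longrightarrow> reset s)) \<omega> \<and>
     alw (holds (\<lambda>s. PC_in_CR L s \<and> W_en s \<and> D_addr s \<notin> addrs (XS L) \<and> D_addr s \<notin> addrs (MR L)
       \<longrightarrow> reset s)) \<omega> \<and>
     alw (holds (\<lambda>s. DMA_en s \<and> DMA_addr s \<in> addrs (KR L) \<longrightarrow> reset s)) \<omega> \<and>
     alw (holds (\<lambda>s. DMA_en s \<and> DMA_addr s \<in> addrs (XS L) \<longrightarrow> reset s)) \<omega> \<and>
     alw (holds (\<lambda>s. PC_in_CR L s \<and> DMA_en s \<longrightarrow> reset s)) \<omega> \<and>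
     alw (holds reset impl ((holds reset suntil holds (\<lambda>s. PC s = 0)) or alw (holds reset))) \<omega>"

definition SW_Att_correct ::
  "layout \<Rightarrow> 'b list \<Rightarrow> 'b list \<Rightarrow> ('b list \<Rightarrow> 'b list \<Rightarrow> 'b list) \<Rightarrow>
   ('b list \<Rightarrow> 'b list \<Rightarrow> 'b list) \<Rightarrow> 'b mcu_state stream \<Rightarrow> bool" where
  "SW_Att_correct L SW_Att K KDF HMAC \<omega> \<longleftrightarrow>
     (\<forall>M Chal. alw
       ((holds (\<lambda>s. PC s = CR_min L \<and> content (MR L) s = Chal) aand
         (holds (\<lambda>s. \<not> reset s \<and> \<not> irq s \<and> content (CR L) s = SW_Att \<and>
                     content (KR L) s = K \<and> content (AR L) s = M)
          suntil holds (\<lambda>s. PC s = CR_max L)))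
        impl ev (holds (\<lambda>s. PC s = CR_max L \<and> content (MR L) s = HMAC (KDF K Chal) M))) \<omega>)"

definition vrased_execution ::
  "layout \<Rightarrow> 'b list \<Rightarrow> 'b list \<Rightarrow> ('b list \<Rightarrow> 'b list \<Rightarrow> 'b list) \<Rightarrow>
   ('b list \<Rightarrow> 'b list \<Rightarrow> 'b list) \<Rightarrow> 'b mcu_state stream \<Rightarrow> bool" where
  "vrased_execution L SW_Att K KDF HMAC \<omega> \<longleftrightarrow>
     memory_model L SW_Att K \<omega> \<and> execution_model \<omega> \<and> hardware_spec L \<omega> \<and>
     SW_Att_correct L SW_Att K KDF HMAC \<omega>"

end

(* Until PC reaches CR_max, a run that enters at CR_min without a reset stays in CR, because (b)
   makes every other exit raise a reset. There (d) excludes irq, (i) excludes DMA accesses and (f)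
   confines CPU writes to XS and MR; both are disjoint from AR, so AR keeps its content M and the
   premise of the functional correctness of SW-Att holds. *)
theory Submission
  imports Defs
begin

text \<open>Induction along the until. Preservation of \<open>I\<close> is demanded only when
  neither of two consecutive states is a goal, so both satisfy \<open>\<phi>\<close>. Knowing
  \<open>\<phi>\<close> at the successor matters later: (b) keeps \<open>PC\<close> inside
  \<open>CR\<close> only if the next state is not a reset.\<close>

lemma suntil_invariant:
  assumes "(\<phi> suntil \<psi>) \<omega>" "I \<omega>"
    and "alw (\<lambda>\<omega>. \<phi> \<omega> \<and> I \<omega> \<and> \<not> \<psi> \<omega> \<and> \<phi> (stl \<omega>) \<and> \<not> \<psi> (stl \<omega>) \<longrightarrow> I (stl \<omega>)) \<omega>"
  shows "((\<phi> aand I) suntil \<psi>) \<omega>"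
  using assms
proof (induction rule: suntil.induct)
  case (base \<omega>)
  then show ?case by (simp add: suntil.base)
next
  case (step \<omega>)
  show ?case
  \<comment> \<open>If the goal is reached now or at the next state, \<open>I\<close> is needed at
    most at the present state, where it is assumed.\<close>
  proof (cases "\<psi> \<omega> \<or> \<psi> (stl \<omega>)")
    case True
    then show ?thesis using step.hyps(1) step.prems(1) by (auto intro: suntil.intros)
  next
    case False
    \<comment> \<open>The tail satisfies the until but not its goal, so its derivation ends with
      \<open>suntil.step\<close>, which yields \<open>\<phi>\<close> there.\<close>
    with step.hyps have "\<phi> (stl \<omega>)" by (auto elim: suntil.cases)
    with False step.hyps step.prems have "I (stl \<omega>)" by (auto dest: alwD)
    then have "((\<phi> aand I) suntil \<psi>) (stl \<omega>)"
      using step.IH step.prems(2) by (auto dest: alw.cases)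
    then show ?thesis using False step.hyps(1) step.prems(1) by (auto intro: suntil.step)
  qed
qed

lemma content_eqI:
  assumes "\<And>i. i \<in> addrs r \<Longrightarrow> mem s i = mem t i"
  shows "content r s = content r t"
  using assms by (auto simp: content_def addrs_def)

lemma CR_min_in_CR: "valid_layout L \<Longrightarrow> CR_min L \<in> addrs (CR L)"
  by (auto simp: valid_layout_def addrs_def CR_def)

text \<open>\<open>XS\<close> and \<open>MR\<close> are the only regions that (f) leaves open to CPU
  writes while \<open>PC\<close> is in \<open>CR\<close>.\<close>

lemma AR_not_writable_region:
  assumes "valid_layout L" "i \<in> addrs (AR L)"
  shows "i \<notin> addrs (XS L)" "i \<notin> addrs (MR L)"
  using assms by (auto simp: valid_layout_def disjnt_iff)

lemma AR_unchanged_in_CR: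
  assumes "valid_layout L" "execution_model \<omega>" "hardware_spec L \<omega>"
    and "PC_in_CR L (shd \<omega>)" "\<not> reset (shd \<omega>)"
  shows "content (AR L) (shd (stl \<omega>)) = content (AR L) (shd \<omega>)"
proof (rule content_eqI, rule ccontr)
  fix i
  assume i: "i \<in> addrs (AR L)" and "mem (shd (stl \<omega>)) i \<noteq> mem (shd \<omega>) i"
  with assms(2) have "Modify_Mem (shd \<omega>) i"
    unfolding execution_model_def by (auto dest!: alwD)
  with assms(2) have "W_en (shd \<omega>) \<and> D_addr (shd \<omega>) = i \<or> DMA_en (shd \<omega>) \<and> DMA_addr (shd \<omega>) = i"
    unfolding execution_model_def by (auto dest!: alwD)
  with assms(3-5) AR_not_writable_region[OF assms(1) i] show False
    unfolding hardware_spec_def by (auto dest!: alwD)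
qed

lemma no_irq_in_CR:
  assumes "hardware_spec L \<omega>" "PC_in_CR L (shd \<omega>)" "\<not> reset (shd \<omega>)"
  shows "\<not> irq (shd \<omega>)"
  using assms unfolding hardware_spec_def by (auto dest!: alwD)

text \<open>The last two hypotheses exclude the two ways in which (b) permits leaving
  \<open>CR\<close>.\<close>

lemma PC_stays_in_CR:
  assumes "hardware_spec L \<omega>" "PC_in_CR L (shd \<omega>)" "\<not> reset (shd \<omega>)"
    and "PC (shd \<omega>) \<noteq> CR_max L" "\<not> reset (shd (stl \<omega>))"
  shows "PC_in_CR L (shd (stl \<omega>))"
  using assms unfolding hardware_spec_def by (auto dest!: alwD)

text \<open>Lets G pass through the quantifiers over \<open>M\<close> and \<open>Chal\<close> in
  \<open>SW_Att_correct\<close>.\<close>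

lemma alw_all: "alw (\<lambda>\<omega>. \<forall>x. \<phi> x \<omega>) \<omega> \<longleftrightarrow> (\<forall>x. alw (\<phi> x) \<omega>)"
  by (auto simp: alw_iff_sdrop)

lemma alw_memory_model: "memory_model L SW_Att K \<omega> \<Longrightarrow> alw (memory_model L SW_Att K) \<omega>"
  unfolding memory_model_def by (simp add: alw_aand all_imp_alw)

lemma alw_execution_model: "execution_model \<omega> \<Longrightarrow> alw execution_model \<omega>"
  unfolding execution_model_def by (simp add: alw_aand)

lemma alw_hardware_spec: "hardware_spec L \<omega> \<Longrightarrow> alw (hardware_spec L) \<omega>"
  unfolding hardware_spec_def by (simp add: alw_aand)

lemma alw_SW_Att_correct:
  "SW_Att_correct L SW_Att K KDF HMAC \<omega> \<Longrightarrow> alw (SW_Att_correct L SW_Att K KDF HMAC) \<omega>"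
  unfolding SW_Att_correct_def by (simp add: alw_all)

text \<open>Every condition is a G formula or concerns the layout alone, so each suffix of an
  execution is again an execution.\<close>

lemma alw_vrased_execution:
  "vrased_execution L SW_Att K KDF HMAC \<omega> \<Longrightarrow> alw (vrased_execution L SW_Att K KDF HMAC) \<omega>"
  unfolding vrased_execution_def
  by (simp add: alw_aand alw_memory_model alw_execution_model alw_hardware_spec alw_SW_Att_correct)

text \<open>Strengthens the until of the theorem, which speaks of \<open>reset\<close> only, to the
  one in the premise of \<open>SW_Att_correct\<close>.\<close>

lemma uninterrupted_attestation:
  assumes "vrased_execution L SW_Att K KDF HMAC \<omega>"
    and "PC (shd \<omega>) = CR_min L" "content (AR L) (shd \<omega>) = M"
    and "(holds (\<lambda>s. \<not> reset s) suntil holds (\<lambda>s. PC s = CR_max L)) \<omega>"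
  shows "(holds (\<lambda>s. \<not> reset s \<and> \<not> irq s \<and> content (CR L) s = SW_Att \<and>
                     content (KR L) s = K \<and> content (AR L) s = M)
          suntil holds (\<lambda>s. PC s = CR_max L)) \<omega>"
proof -
  \<comment> \<open>Carrying the whole execution in the invariant makes all specifications available
    at every suffix, so preservation can be shown for an arbitrary stream.\<close>
  let ?I = "\<lambda>\<omega>. vrased_execution L SW_Att K KDF HMAC \<omega> \<and> PC_in_CR L (shd \<omega>) \<and>
    content (AR L) (shd \<omega>) = M"
  let ?\<phi> = "holds (\<lambda>s. \<not> reset s)" and ?\<psi> = "holds (\<lambda>s. PC s = CR_max L)"
  have valid: "valid_layout L"
    using assms(1) by (simp add: vrased_execution_def memory_model_def)
  have "?I \<omega>"
    using assms(1-3) CR_min_in_CR[OF valid] by simp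
  moreover have "alw (\<lambda>\<omega>. ?\<phi> \<omega> \<and> ?I \<omega> \<and> \<not> ?\<psi> \<omega> \<and> ?\<phi> (stl \<omega>) \<and> \<not> ?\<psi> (stl \<omega>) \<longrightarrow> ?I (stl \<omega>)) \<omega>"
  proof (rule all_imp_alw, intro allI impI)
    fix \<omega>' :: "'a mcu_state stream"
    assume *: "?\<phi> \<omega>' \<and> ?I \<omega>' \<and> \<not> ?\<psi> \<omega>' \<and> ?\<phi> (stl \<omega>') \<and> \<not> ?\<psi> (stl \<omega>')"
    then have spec: "execution_model \<omega>'" "hardware_spec L \<omega>'"
      by (auto simp: vrased_execution_def)
    have "vrased_execution L SW_Att K KDF HMAC (stl \<omega>')"
      using * alw_vrased_execution by (metis alw.cases alwD)
    moreover have "PC_in_CR L (shd (stl \<omega>'))"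
      using * PC_stays_in_CR[OF spec(2)] by simp
    moreover have "content (AR L) (shd (stl \<omega>')) = M"
      using * AR_unchanged_in_CR[OF valid spec] by simp
    ultimately show "?I (stl \<omega>')" by simp
  qed
  ultimately have "((?\<phi> aand ?I) suntil ?\<psi>) \<omega>"
    by (intro suntil_invariant[OF assms(4)])
  \<comment> \<open>The invariant suffices, hence \<open>P = true\<close>: the memory model gives
    the contents of \<open>CR\<close> and \<open>KR\<close>, and (d) excludes
    \<open>irq\<close>.\<close>
  then show ?thesis
    by (rule suntil_mono[where P = true, rotated 2])
      (auto simp: vrased_execution_def memory_model_def intro: all_imp_alw dest: alwD no_irq_in_CR)
qed

theorem theorem1:
  fixes L :: layout
    and SW_Att K :: "'b list"
    and KDF HMAC :: "'b list \<Rightarrow> 'b list \<Rightarrow> 'b list"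
    and \<omega> :: "'b mcu_state stream"
  assumes "vrased_execution L SW_Att K KDF HMAC \<omega>"
  shows "\<forall>M Chal. alw
    ((holds (\<lambda>s. PC s = CR_min L \<and> content (AR L) s = M \<and> content (MR L) s = Chal) aand
      (holds (\<lambda>s. \<not> reset s) suntil holds (\<lambda>s. PC s = CR_max L)))
     impl ev (holds (\<lambda>s. PC s = CR_max L \<and> content (MR L) s = HMAC (KDF K Chal) M))) \<omega>"
\<comment> \<open>It is enough to treat one suffix, itself an execution, whose first state is the
  entry state.\<close>
proof (intro allI alw_mono[OF alw_vrased_execution[OF assms]] impI)
  fix M Chal :: "'b list" and \<omega>' :: "'b mcu_state stream"
  assume exec: "vrased_execution L SW_Att K KDF HMAC \<omega>'"
    and entry: "(holds (\<lambda>s. PC s = CR_min L \<and> content (AR L) s = M \<and> content (MR L) s = Chal) aand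
      (holds (\<lambda>s. \<not> reset s) suntil holds (\<lambda>s. PC s = CR_max L))) \<omega>'"
  have "SW_Att_correct L SW_Att K KDF HMAC \<omega>'"
    using exec by (simp add: vrased_execution_def)
  then show "ev (holds (\<lambda>s. PC s = CR_max L \<and> content (MR L) s = HMAC (KDF K Chal) M)) \<omega>'"
    using entry uninterrupted_attestation[OF exec]
    unfolding SW_Att_correct_def by (auto dest!: alwD)
qed

end
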